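(* Let the ruled surfaces $\varphi_e$ and $\varphi_{e_1}$ form a Mannheim surface offset, with dual offset angle $\bar\theta=\theta+\varepsilon\theta^*$. Then the Mannheim offset $\varphi_{e_1}$ is developable if and only if $$\theta^*=-\frac{\delta}{\gamma}\tan\theta$$ holds.
   Context: Dual numbers: $D=\{a+\varepsilon a^*: a,a^*\in\mathbb{R}\}$ with $\varepsilon^2=0$. A differentiable real function $f$ extends to $D$ by $f(x+\varepsilon x^* )=f(x)+\varepsilon x^* f'(x)$; in particular this defines $\sin$, $\cos$. Dual vectors are $\tilde a=\vec a+\varepsilon\vec a^*$ with $\vec a,\vec a^*\in\mathbb{R}^3$; scalar and cross products are extended $D$-bilinearly. Ruled surface: all functions are smooth. $\varphi_e(s,v)=\vec c(s)+v\,\vec e(s)$, $s$ in an open interval, where $\langle\vec e,\vec e\rangle=1$, $s$ is the arc-length of the spherical curve $\vec e$, i.e. $\langle\vec e\,',\vec e\,'\rangle=1$, and $\vec c$ is the striction curve, i.e. $\langle\vec c\,',\vec e\,'\rangle=0$ (prime $=d/ds$). Put $\vec t=\vec e\,'$, $\vec g=\vec e\times\vec t$. The conical curvature $\gamma$ is defined by $\vec t\,'=\gamma\vec g-\vec e$ (so $\vec g\,'=-\gamma\vec t$). Put $\Delta=\det(\vec c\,',\vec e,\vec t)$ and $\delta=\langle\vec c\,',\vec e\rangle$. The surface is developable means $\Delta=0$ identically. The ruled surface is represented by the dual unit vector $\tilde e=\vec e+\varepsilon\,\vec c\times\vec e$; its dual Darboux frame is $\{\tilde e,\tilde t,\tilde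 g\}$ with $\tilde t=\vec t+\varepsilon\,\vec c\times\vec t$, $\tilde g=\vec g+\varepsilon\,\vec c\times\vec g$. A second ruled surface $\varphi_{e_1}$ is given in the same way; the same symbols with index $1$ ($s_1,\vec c_1,\vec e_1,\vec t_1,\vec g_1,\gamma_1,\Delta_1,\delta_1,\tilde e_1,\tilde t_1,\tilde g_1$) denote its corresponding objects, with derivatives taken with respect to $s_1$; so $\varphi_{e_1}$ is developable means $\Delta_1=0$ identically. Mannheim surface offset: $\varphi_e$ and $\varphi_{e_1}$ are Mannheim surface offsets if there is a one-to-one correspondence $s\mapsto s_1(s)$ between their rulings (smooth, with $ds_1/ds\neq0$) such that $\tilde g=\tilde t_1$ at corresponding parameters. Then the frames are related by $\tilde e_1=\cos\bar\theta\,\tilde e+\sin\bar\theta\,\tilde t$, $\tilde t_1=\tilde g$, $\tilde g_1=\sin\bar\theta\,\tilde e-\cos\bar\theta\,\tilde t$, where $\bar\theta=\theta+\varepsilon\theta^*$ (a smooth function of $s$, with $0\le\theta\le\pi$, $\theta^*\in\mathbb{R}$) is the dual angle between $\tilde e$ and $\tilde e_1$, called the dual offset angle; $\theta$ is the offset angle and $\theta^*$ the offset distance. The equation involving $\tan\theta$ is understood for parameters where $\tan\theta$ is defined, i.e. $\cos\theta\neq0$ is understood on the parameter interval. *)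

theory Defs
  imports "HOL-Analysis.Analysis"
begin

section \<open>Dual numbers and dual vectors\<close>

text \<open>\<open>Dual a b\<close> stands for \<open>a + \<epsilon> b\<close> with \<open>\<epsilon>\<^sup>2 = 0\<close>.\<close>

datatype dual_number = Dual (real_part: real) (dual_part: real)

instantiation dual_number :: comm_ring_1
begin

definition "0 = Dual 0 0"
definition "1 = Dual 1 0"
definition "x + y = Dual (real_part x + real_part y) (dual_part x + dual_part y)"
definition "x - y = Dual (real_part x - real_part y) (dual_part x - dual_part y)"
definition "- x = Dual (- real_part x) (- dual_part x)"
definition "x * y = Dual (real_part x * real_part y)
                         (real_part x * dual_part y + dual_part x * real_part y)"

instance
  by standard
    (simp_all add: zero_dual_number_def one_dual_number_def plus_dual_number_def
      minus_dual_number_def uminus_dual_number_def times_dual_number_def algebra_simps)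

end

definition dual_extend :: "(real \<Rightarrow> real) \<Rightarrow> dual_number \<Rightarrow> dual_number" where
  "dual_extend f z = Dual (f (real_part z)) (dual_part z * deriv f (real_part z))"

definition dual_sin :: "dual_number \<Rightarrow> dual_number" where
  "dual_sin = dual_extend sin"

definition dual_cos :: "dual_number \<Rightarrow> dual_number" where
  "dual_cos = dual_extend cos"

text \<open>Dual vectors have type \<open>dual_number ^ 3\<close>; scaling by a dual number is \<open>*s\<close>.\<close>

definition dual_vector :: "real^3 \<Rightarrow> real^3 \<Rightarrow> dual_number^3" where
  "dual_vector a b = (\<chi> i. Dual (a $ i) (b $ i))"


section \<open>Ruled surfaces\<close>

text \<open>On an open set \<open>I\<close> this is smoothness: derivatives of all orders exist at every
  point of \<open>I\<close>. Since \<open>I\<close> is open, the values of \<open>f\<close> outside \<open>I\<close> do not matter.\<close>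

definition smooth_on :: "real set \<Rightarrow> (real \<Rightarrow> 'a::real_normed_vector) \<Rightarrow> bool" where
  "smooth_on I f \<longleftrightarrow>
     (\<forall>n. \<forall>s\<in>I. ((\<lambda>g t. vector_derivative g (at t)) ^^ n) f differentiable at s)"

definition central_normal :: "(real \<Rightarrow> real^3) \<Rightarrow> real \<Rightarrow> real^3" where
  "central_normal e s = vector_derivative e (at s)"

definition asymptotic_normal :: "(real \<Rightarrow> real^3) \<Rightarrow> real \<Rightarrow> real^3" where
  "asymptotic_normal e s = cross3 (e s) (central_normal e s)"

text \<open>\<open>\<phi>\<close> is the ruled surface with striction curve \<open>c\<close> and unit ruling direction \<open>e\<close>,
  parametrised over \<open>I\<close> by the arc length of the spherical curve \<open>e\<close>.\<close>

definition ruled_surface ::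
  "real set \<Rightarrow> (real \<Rightarrow> real \<Rightarrow> real^3) \<Rightarrow> (real \<Rightarrow> real^3) \<Rightarrow> (real \<Rightarrow> real^3) \<Rightarrow> bool" where
  "ruled_surface I \<phi> c e \<longleftrightarrow>
     open I \<and> is_interval I \<and> I \<noteq> {} \<and>
     smooth_on I c \<and> smooth_on I e \<and>
     (\<forall>s\<in>I. \<forall>v. \<phi> s v = c s + v *\<^sub>R e s) \<and>
     (\<forall>s\<in>I. e s \<bullet> e s = 1) \<and>
     (\<forall>s\<in>I. vector_derivative e (at s) \<bullet> vector_derivative e (at s) = 1) \<and>
     (\<forall>s\<in>I. vector_derivative c (at s) \<bullet> vector_derivative e (at s) = 0)"

text \<open>The coefficient in \<open>t' = \<gamma> g - e\<close>; it is unique because \<open>g\<close> is a unit vector.\<close>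

definition conical_curvature :: "(real \<Rightarrow> real^3) \<Rightarrow> real \<Rightarrow> real" where
  "conical_curvature e s =
     (THE k. vector_derivative (central_normal e) (at s) = k *\<^sub>R asymptotic_normal e s - e s)"

text \<open>The functions \<open>\<Delta> = det (c', e, t)\<close> and \<open>\<delta> = \<langle>c', e\<rangle>\<close>.\<close>

definition Delta_fun :: "(real \<Rightarrow> real^3) \<Rightarrow> (real \<Rightarrow> real^3) \<Rightarrow> real \<Rightarrow> real" where
  "Delta_fun c e s =
     det (vector [vector_derivative c (at s), e s, central_normal e s] :: real^3^3)"

definition delta_fun :: "(real \<Rightarrow> real^3) \<Rightarrow> (real \<Rightarrow> real^3) \<Rightarrow> real \<Rightarrow> real" where
  "delta_fun c e s = vector_derivative c (at s) \<bullet> e s"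

definition developable :: "real set \<Rightarrow> (real \<Rightarrow> real^3) \<Rightarrow> (real \<Rightarrow> real^3) \<Rightarrow> bool" where
  "developable I c e \<longleftrightarrow> (\<forall>s\<in>I. Delta_fun c e s = 0)"


section \<open>Dual Darboux frame and Mannheim offsets\<close>

text \<open>The oriented line through \<open>c s\<close> with direction \<open>x s\<close>, as \<open>x + \<epsilon> c \<times> x\<close>.\<close>

definition dual_line :: "(real \<Rightarrow> real^3) \<Rightarrow> (real \<Rightarrow> real^3) \<Rightarrow> real \<Rightarrow> dual_number^3" where
  "dual_line c x s = dual_vector (x s) (cross3 (c s) (x s))"

definition dual_e :: "(real \<Rightarrow> real^3) \<Rightarrow> (real \<Rightarrow> real^3) \<Rightarrow> real \<Rightarrow> dual_number^3" where
  "dual_e c e = dual_line c e"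

definition dual_t :: "(real \<Rightarrow> real^3) \<Rightarrow> (real \<Rightarrow> real^3) \<Rightarrow> real \<Rightarrow> dual_number^3" where
  "dual_t c e = dual_line c (central_normal e)"

definition dual_g :: "(real \<Rightarrow> real^3) \<Rightarrow> (real \<Rightarrow> real^3) \<Rightarrow> real \<Rightarrow> dual_number^3" where
  "dual_g c e = dual_line c (asymptotic_normal e)"

text \<open>\<open>\<sigma>\<close> is the correspondence \<open>s \<mapsto> s\<^sub>1(s)\<close> between the rulings of the two surfaces.\<close>

definition mannheim_offset ::
  "real set \<Rightarrow> (real \<Rightarrow> real^3) \<Rightarrow> (real \<Rightarrow> real^3) \<Rightarrow>
   real set \<Rightarrow> (real \<Rightarrow> real^3) \<Rightarrow> (real \<Rightarrow> real^3) \<Rightarrow> (real \<Rightarrow> real) \<Rightarrow> bool" where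
  "mannheim_offset I c e I\<^sub>1 c\<^sub>1 e\<^sub>1 \<sigma> \<longleftrightarrow>
     bij_betw \<sigma> I I\<^sub>1 \<and> smooth_on I \<sigma> \<and> (\<forall>s\<in>I. deriv \<sigma> s \<noteq> 0) \<and>
     (\<forall>s\<in>I. dual_g c e s = dual_t c\<^sub>1 e\<^sub>1 (\<sigma> s))"

text \<open>The range \<open>[0, \<pi>]\<close> of the real part and the frame relations together fix the dual
  angle between \<open>dual_e c e\<close> and \<open>dual_e c\<^sub>1 e\<^sub>1\<close>, including the sign of its sine.\<close>

definition dual_offset_angle ::
  "real set \<Rightarrow> (real \<Rightarrow> real^3) \<Rightarrow> (real \<Rightarrow> real^3) \<Rightarrow>
   (real \<Rightarrow> real^3) \<Rightarrow> (real \<Rightarrow> real^3) \<Rightarrow> (real \<Rightarrow> real) \<Rightarrow> (real \<Rightarrow> dual_number) \<Rightarrow> bool" where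
  "dual_offset_angle I c e c\<^sub>1 e\<^sub>1 \<sigma> \<Theta> \<longleftrightarrow>
     smooth_on I (\<lambda>s. real_part (\<Theta> s)) \<and> smooth_on I (\<lambda>s. dual_part (\<Theta> s)) \<and>
     (\<forall>s\<in>I. 0 \<le> real_part (\<Theta> s) \<and> real_part (\<Theta> s) \<le> pi) \<and>
     (\<forall>s\<in>I. dual_e c\<^sub>1 e\<^sub>1 (\<sigma> s) = dual_cos (\<Theta> s) *s dual_e c e s + dual_sin (\<Theta> s) *s dual_t c e s) \<and>
     (\<forall>s\<in>I. dual_g c\<^sub>1 e\<^sub>1 (\<sigma> s) = dual_sin (\<Theta> s) *s dual_e c e s - dual_cos (\<Theta> s) *s dual_t c e s)"

end

theory Submission
  imports Defs
begin

text \<open>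
  Because the ruling direction is parametrised by its arc length, \<open>{e, t, g}\<close> is an
  orthonormal frame with \<open>t' = \<gamma> g - e\<close> and \<open>g' = - \<gamma> t\<close>, and \<open>{e\<^sub>1, t\<^sub>1, g\<^sub>1}\<close> is
  another one with \<open>t\<^sub>1 = g\<close> and \<open>e\<^sub>1\<close>, \<open>g\<^sub>1\<close> in the plane of \<open>e\<close> and \<open>t\<close>. Below, \<open>\<theta>\<^sup>*\<close> is the
  dual part of the offset angle, the variable \<open>\<theta>\<^sub>d\<close>. Two facts about corresponding parameters
  \<open>s\<close> and \<open>\<sigma> s\<close> carry the proof.

  The dual parts of the frame relations say where the second line lies: \<open>t\<^sub>1\<close> and \<open>g\<close> span
  the same line, so \<open>c\<^sub>1 - c\<close> is a multiple of \<open>g\<close>, and the moment of \<open>e\<^sub>1\<close> identifies the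
  multiple. Hence \<open>c\<^sub>1 \<circ> \<sigma> = c + \<theta>\<^sup>* g\<close> (lemma \<open>mannheim_striction_curve\<close>).

  Differentiating \<open>e\<^sub>1 \<circ> \<sigma> = cos \<theta> e + sin \<theta> t\<close> and taking the component along \<open>g\<close> yields
  \<open>\<sigma>' = \<gamma> sin \<theta>\<close> (lemma \<open>mannheim_speed\<close>). As \<open>\<sigma>'\<close> has no zeros, neither has \<open>\<gamma>\<close>, so the
  quotient \<open>\<delta> / \<gamma>\<close> in the criterion is a genuine one.

  Finally \<open>\<Delta>\<^sub>1 = \<langle>c\<^sub>1', g\<^sub>1\<rangle>\<close>, and differentiating \<open>c\<^sub>1 \<circ> \<sigma> = c + \<theta>\<^sup>* g\<close> gives
  \<open>\<sigma>' \<Delta>\<^sub>1 = \<delta> sin \<theta> + \<gamma> \<theta>\<^sup>* cos \<theta>\<close> (lemma \<open>mannheim_Delta\<close>). Dividing by \<open>\<gamma> cos \<theta>\<close> turns the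
  vanishing of the right-hand side into \<open>\<theta>\<^sup>* = - (\<delta> / \<gamma>) tan \<theta>\<close>.
\<close>

section \<open>Dual vectors as pairs of real vectors\<close>

lemma dual_vector_eq_iff: "dual_vector a b = dual_vector a' b' \<longleftrightarrow> a = a' \<and> b = b'"
  by (auto simp: dual_vector_def vec_eq_iff)

lemma dual_vector_add: "dual_vector a b + dual_vector a' b' = dual_vector (a + a') (b + b')"
  by (simp add: dual_vector_def vec_eq_iff plus_dual_number_def)

lemma dual_vector_scale: "Dual p q *s dual_vector a b = dual_vector (p *\<^sub>R a) (p *\<^sub>R b + q *\<^sub>R a)"
  by (simp add: dual_vector_def vec_eq_iff times_dual_number_def vector_scalar_mult_def)

lemma dual_cos_Dual: "dual_cos (Dual x y) = Dual (cos x) (- (y * sin x))"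
  by (simp add: dual_cos_def dual_extend_def DERIV_imp_deriv[OF DERIV_cos])

lemma dual_sin_Dual: "dual_sin (Dual x y) = Dual (sin x) (y * cos x)"
  by (simp add: dual_sin_def dual_extend_def DERIV_imp_deriv[OF DERIV_sin])

text \<open>A unit vector \<open>a\<close> and the moment \<open>x \<times> a\<close> fix \<open>x\<close> up to a multiple of \<open>a\<close>; a second direction
  removes this freedom. With \<open>a\<close> and \<open>b\<close> as directions of two lines through a common point,
  this locates the point from the dual parts of the two dual vectors.\<close>

lemma eq_if_cross_orthonormal_eq:
  fixes x y a b :: "real^3"
  assumes "a \<bullet> a = 1" "b \<bullet> b = 1" "a \<bullet> b = 0"
    and "cross3 x a = cross3 y a" "cross3 x b = cross3 y b"
  shows "x = y"
proof -
  define z where "z = x - y"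
  have "cross3 z a = 0" "cross3 z b = 0"
    using assms(4,5) by (simp_all add: z_def Cross3.left_diff_distrib)
  then have "cross3 a (cross3 z a) = 0" "cross3 b (cross3 z b) = 0"
    by simp_all
  then have za: "z = (a \<bullet> z) *\<^sub>R a" and zb: "z = (b \<bullet> z) *\<^sub>R b"
    using assms(1,2) by (simp_all add: Lagrange)
  have "a \<bullet> z = 0"
    using arg_cong[OF zb, of "inner a"] assms(3) by simp
  then show ?thesis
    using za by (simp add: z_def)
qed


section \<open>Derivatives of smooth curves\<close>

lemma smooth_on_has_vector_derivative:
  assumes "smooth_on I f" "s \<in> I"
  shows "(f has_vector_derivative vector_derivative f (at s)) (at s)"
proof -
  have "((\<lambda>g t. vector_derivative g (at t)) ^^ 0) f differentiable at s"
    using assms unfolding smooth_on_def by blast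
  then show ?thesis
    by (simp add: vector_derivative_works)
qed

lemma smooth_on_derivative:
  assumes "smooth_on I f"
  shows "smooth_on I (\<lambda>t. vector_derivative f (at t))"
  unfolding smooth_on_def
proof (intro allI ballI)
  fix n s assume "s \<in> I"
  then have "((\<lambda>g t. vector_derivative g (at t)) ^^ Suc n) f differentiable at s"
    using assms unfolding smooth_on_def by blast
  then show "((\<lambda>g t. vector_derivative g (at t)) ^^ n) (\<lambda>t. vector_derivative f (at t)) 
      differentiable at s"
    by (simp only: funpow_Suc_right o_def)
qed

lemma smooth_on_has_real_derivative:
  fixes f :: "real \<Rightarrow> real"
  assumes "smooth_on I f" "s \<in> I"
  shows "(f has_real_derivative deriv f s) (at s)"
  using smooth_on_has_vector_derivative[OF assms]
  by (metis DERIV_imp_deriv has_real_derivative_iff_has_vector_derivative)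

lemma has_vector_derivative_eq_on_open:
  assumes "open I" "s \<in> I" "\<And>u. u \<in> I \<Longrightarrow> f u = g u"
    and "(f has_vector_derivative f') (at s)" "(g has_vector_derivative g') (at s)"
  shows "f' = g'"
  using assms has_vector_derivative_transform_within_open[of f f' s I g]
  by (auto intro: vector_derivative_unique_at)


section \<open>The Darboux frame of a ruled surface\<close>

text \<open>The part of a ruled surface that determines its frame, kept apart from the striction
  curve so that it applies to \<open>e\<close> and to \<open>e\<^sub>1\<close> alike.\<close>

locale spherical_curve =
  fixes I :: "real set" and e :: "real \<Rightarrow> real^3"
  assumes open_I: "open I" and smooth: "smooth_on I e"
    and unit_e: "s \<in> I \<Longrightarrow> e s \<bullet> e s = 1"
    and unit_t: "s \<in> I \<Longrightarrow> central_normal e s \<bullet> central_normal e s = 1"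
begin

abbreviation "t \<equiv> central_normal e"
abbreviation "g \<equiv> asymptotic_normal e"
abbreviation "\<gamma> \<equiv> conical_curvature e"

lemma e_derivative: "s \<in> I \<Longrightarrow> (e has_vector_derivative t s) (at s)"
  using smooth_on_has_vector_derivative[OF smooth] by (simp add: central_normal_def)

lemma t_has_derivative: "s \<in> I \<Longrightarrow> (t has_vector_derivative vector_derivative t (at s)) (at s)"
proof -
  have "smooth_on I t"
    using smooth_on_derivative[OF smooth] by (simp add: central_normal_def[abs_def])
  then show "s \<in> I \<Longrightarrow> ?thesis" by (rule smooth_on_has_vector_derivative)
qed

lemma inner_derivative_eq:
  fixes x y :: "real \<Rightarrow> real^3"
  assumes "s \<in> I" "\<And>u. u \<in> I \<Longrightarrow> x u \<bullet> y u = k"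
    and "(x has_vector_derivative x') (at s)" "(y has_vector_derivative y') (at s)"
  shows "x s \<bullet> y' + x' \<bullet> y s = 0"
proof (rule has_vector_derivative_eq_on_open[OF open_I assms(1)])
  show "((\<lambda>u. x u \<bullet> y u) has_vector_derivative x s \<bullet> y' + x' \<bullet> y s) (at s)"
    using bounded_bilinear.has_vector_derivative[OF bounded_bilinear_inner assms(3,4)] .
  show "((\<lambda>u. k) has_vector_derivative 0) (at s)" by simp
qed (use assms(2) in simp)

lemma e_t: "s \<in> I \<Longrightarrow> e s \<bullet> t s = 0"
  using inner_derivative_eq[of s e e 1, OF _ unit_e e_derivative e_derivative]
  by (simp add: inner_commute)

lemma e_g: "e s \<bullet> g s = 0" and t_g: "t s \<bullet> g s = 0"
  by (simp_all add: asymptotic_normal_def dot_cross_self)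

lemma unit_g: "s \<in> I \<Longrightarrow> g s \<bullet> g s = 1"
  using norm_cross_dot[of "e s" "t s"] e_t unit_e unit_t
  by (simp add: asymptotic_normal_def power_mult_distrib power2_norm_eq_inner)

lemma e_cross_g: "s \<in> I \<Longrightarrow> cross3 (e s) (g s) = - t s"
  using e_t unit_e by (simp add: asymptotic_normal_def Lagrange)

lemma t_cross_g: "s \<in> I \<Longrightarrow> cross3 (t s) (g s) = e s"
  using e_t unit_t by (simp add: asymptotic_normal_def Lagrange inner_commute)

text \<open>Differentiating \<open>\<langle>t, t\<rangle> = 1\<close> and \<open>\<langle>e, t\<rangle> = 0\<close> determines the components of \<open>t'\<close> along
  \<open>t\<close> and \<open>e\<close>, and only the component along \<open>g\<close>, which is \<open>\<gamma>\<close>, is left free.\<close>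

lemma t_derivative:
  assumes s: "s \<in> I"
  shows "(t has_vector_derivative \<gamma> s *\<^sub>R g s - e s) (at s)"
proof -
  define t' where "t' = vector_derivative t (at s)"
  have t': "(t has_vector_derivative t') (at s)"
    using t_has_derivative[OF s] by (simp add: t'_def)
  have tt': "t s \<bullet> t' = 0"
    using inner_derivative_eq[OF s unit_t t' t'] by (simp add: inner_commute)
  have et': "e s \<bullet> t' = -1"
    using inner_derivative_eq[OF s e_t e_derivative[OF s] t'] unit_t[OF s] by simp
  define k where "k = g s \<bullet> (t' + e s)"
  \<comment> \<open>\<open>t' + e\<close> is orthogonal to \<open>e\<close> and \<open>t\<close>, hence parallel to \<open>g = e \<times> t\<close>.\<close>
  have "cross3 (t' + e s) (g s) = 0"
    using tt' et' e_t[OF s] unit_e[OF s]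
    by (simp add: asymptotic_normal_def Lagrange inner_add_right inner_commute)
  then have "cross3 (g s) (cross3 (t' + e s) (g s)) = 0"
    by simp
  then have "t' = k *\<^sub>R g s - e s"
    using unit_g[OF s] by (simp add: Lagrange k_def algebra_simps)
  moreover from this have "\<gamma> s = k"
    unfolding conical_curvature_def t'_def[symmetric]
    using unit_g[OF s] by (intro the_equality) auto
  ultimately show ?thesis
    using t' by simp
qed

lemma g_derivative:
  assumes s: "s \<in> I"
  shows "(g has_vector_derivative - \<gamma> s *\<^sub>R t s) (at s)"
proof -
  have "(g has_vector_derivative cross3 (e s) (\<gamma> s *\<^sub>R g s - e s) + cross3 (t s) (t s)) (at s)"
    unfolding asymptotic_normal_def[abs_def]
    using bounded_bilinear.has_vector_derivative
      [OF _ e_derivative[OF s] t_derivative[OF s, unfolded asymptotic_normal_def]]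
      bilinear_cross bilinear_conv_bounded_bilinear by blast
  moreover have "cross3 (e s) (\<gamma> s *\<^sub>R g s - e s) + cross3 (t s) (t s) = - \<gamma> s *\<^sub>R t s"
    using e_cross_g[OF s] by (simp add: Cross3.right_diff_distrib cross_mult_right)
  ultimately show ?thesis by simp
qed

end


section \<open>Mannheim offsets\<close>

locale mannheim_pair =
  fixes I I\<^sub>1 :: "real set"
    and \<phi> \<phi>\<^sub>1 :: "real \<Rightarrow> real \<Rightarrow> real^3"
    and c e c\<^sub>1 e\<^sub>1 :: "real \<Rightarrow> real^3"
    and \<sigma> \<theta> \<theta>\<^sub>d :: "real \<Rightarrow> real"
  assumes surface_ruled: "ruled_surface I \<phi> c e"
    and offset_ruled: "ruled_surface I\<^sub>1 \<phi>\<^sub>1 c\<^sub>1 e\<^sub>1"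
    and offset: "mannheim_offset I c e I\<^sub>1 c\<^sub>1 e\<^sub>1 \<sigma>"
    and angle: "dual_offset_angle I c e c\<^sub>1 e\<^sub>1 \<sigma> (\<lambda>s. Dual (\<theta> s) (\<theta>\<^sub>d s))"

sublocale mannheim_pair \<subseteq> surface: spherical_curve I e
  using surface_ruled by unfold_locales (auto simp: ruled_surface_def central_normal_def)

sublocale mannheim_pair \<subseteq> offset: spherical_curve I\<^sub>1 e\<^sub>1
  using offset_ruled by unfold_locales (auto simp: ruled_surface_def central_normal_def)

context mannheim_pair
begin

lemma \<sigma>_mem: "s \<in> I \<Longrightarrow> \<sigma> s \<in> I\<^sub>1"
  using offset by (auto simp: mannheim_offset_def bij_betw_def)

lemma \<sigma>_derivative: "s \<in> I \<Longrightarrow> (\<sigma> has_real_derivative deriv \<sigma> s) (at s)"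
  using offset by (intro smooth_on_has_real_derivative) (auto simp: mannheim_offset_def)

lemma angle_derivative: "s \<in> I \<Longrightarrow> (\<theta> has_real_derivative deriv \<theta> s) (at s)"
  and distance_derivative: "s \<in> I \<Longrightarrow> (\<theta>\<^sub>d has_real_derivative deriv \<theta>\<^sub>d s) (at s)"
  using angle by (auto intro!: smooth_on_has_real_derivative simp: dual_offset_angle_def)

lemma has_vector_derivative_along_\<sigma>:
  assumes "s \<in> I" "(f has_vector_derivative f') (at (\<sigma> s))"
  shows "((\<lambda>u. f (\<sigma> u)) has_vector_derivative deriv \<sigma> s *\<^sub>R f') (at s)"
  using vector_diff_chain_at[of \<sigma> "deriv \<sigma> s" s f f'] \<sigma>_derivative[OF assms(1)] assms(2)
  by (simp add: has_real_derivative_iff_has_vector_derivative o_def)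

lemma offset_t:
  assumes "s \<in> I"
  shows "offset.t (\<sigma> s) = surface.g s"
    and "cross3 (c\<^sub>1 (\<sigma> s)) (offset.t (\<sigma> s)) = cross3 (c s) (surface.g s)"
  using offset assms
  by (auto simp: mannheim_offset_def dual_g_def dual_t_def dual_line_def dual_vector_eq_iff)

lemma offset_e:
  assumes "s \<in> I"
  shows "e\<^sub>1 (\<sigma> s) = cos (\<theta> s) *\<^sub>R e s + sin (\<theta> s) *\<^sub>R surface.t s"
    and "cross3 (c\<^sub>1 (\<sigma> s)) (e\<^sub>1 (\<sigma> s)) =
      cross3 (c s) (e\<^sub>1 (\<sigma> s)) + \<theta>\<^sub>d s *\<^sub>R (cos (\<theta> s) *\<^sub>R surface.t s - sin (\<theta> s) *\<^sub>R e s)"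
proof -
  have "dual_e c\<^sub>1 e\<^sub>1 (\<sigma> s) =
      dual_cos (Dual (\<theta> s) (\<theta>\<^sub>d s)) *s dual_e c e s + dual_sin (Dual (\<theta> s) (\<theta>\<^sub>d s)) *s dual_t c e s"
    using angle assms by (simp add: dual_offset_angle_def)
  then have *: "e\<^sub>1 (\<sigma> s) = cos (\<theta> s) *\<^sub>R e s + sin (\<theta> s) *\<^sub>R surface.t s \<and>
      cross3 (c\<^sub>1 (\<sigma> s)) (e\<^sub>1 (\<sigma> s)) =
        cos (\<theta> s) *\<^sub>R cross3 (c s) (e s) + (- (\<theta>\<^sub>d s * sin (\<theta> s))) *\<^sub>R e s +
        (sin (\<theta> s) *\<^sub>R cross3 (c s) (surface.t s) + (\<theta>\<^sub>d s * cos (\<theta> s)) *\<^sub>R surface.t s)"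
    unfolding dual_cos_Dual dual_sin_Dual dual_e_def dual_t_def dual_line_def
      dual_vector_scale dual_vector_add dual_vector_eq_iff .
  show "e\<^sub>1 (\<sigma> s) = cos (\<theta> s) *\<^sub>R e s + sin (\<theta> s) *\<^sub>R surface.t s"
    using * by (rule conjunct1)
  show "cross3 (c\<^sub>1 (\<sigma> s)) (e\<^sub>1 (\<sigma> s)) =
      cross3 (c s) (e\<^sub>1 (\<sigma> s)) + \<theta>\<^sub>d s *\<^sub>R (cos (\<theta> s) *\<^sub>R surface.t s - sin (\<theta> s) *\<^sub>R e s)"
    unfolding *[THEN conjunct2] unfolding *[THEN conjunct1]
    by (simp add: cross_add_right cross_mult_right algebra_simps)
qed

lemma offset_g:
  assumes "s \<in> I"
  shows "offset.g (\<sigma> s) = sin (\<theta> s) *\<^sub>R e s - cos (\<theta> s) *\<^sub>R surface.t s"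
  using surface.e_cross_g[OF assms] surface.t_cross_g[OF assms] 
  unfolding asymptotic_normal_def[of e\<^sub>1] offset_t(1)[OF assms] offset_e(1)[OF assms]
  by (simp add: cross_add_left cross_mult_left)

text \<open>Both points are tested against the orthonormal directions \<open>e\<^sub>1\<close> and \<open>t\<^sub>1 = g\<close>. A shift along
  \<open>g\<close> preserves the moment of \<open>g\<close>, and since \<open>g \<times> e\<^sub>1 = - g\<^sub>1\<close>, a shift by \<open>\<theta>\<^sup>* g\<close> changes the
  moment of \<open>e\<^sub>1\<close> by exactly the dual part that \<open>\<theta>\<^sup>*\<close> contributes to the frame relation.\<close>

lemma mannheim_striction_curve:
  assumes s: "s \<in> I"
  shows "c\<^sub>1 (\<sigma> s) = c s + \<theta>\<^sub>d s *\<^sub>R surface.g s"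
proof (rule eq_if_cross_orthonormal_eq)
  have "cross3 (surface.g s) (e\<^sub>1 (\<sigma> s)) = - offset.g (\<sigma> s)"
    by (simp add: asymptotic_normal_def[of e\<^sub>1] offset_t(1)[OF s] flip: cross_skew)
  then have "cross3 (surface.g s) (e\<^sub>1 (\<sigma> s)) = cos (\<theta> s) *\<^sub>R surface.t s - sin (\<theta> s) *\<^sub>R e s"
    by (simp add: offset_g[OF s])
  then show "cross3 (c\<^sub>1 (\<sigma> s)) (e\<^sub>1 (\<sigma> s)) = cross3 (c s + \<theta>\<^sub>d s *\<^sub>R surface.g s) (e\<^sub>1 (\<sigma> s))"
    by (simp add: offset_e(2)[OF s] cross_add_left cross_mult_left)
  show "cross3 (c\<^sub>1 (\<sigma> s)) (offset.t (\<sigma> s)) =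
      cross3 (c s + \<theta>\<^sub>d s *\<^sub>R surface.g s) (offset.t (\<sigma> s))"
    unfolding offset_t(2)[OF s] by (simp add: offset_t(1)[OF s] cross_add_left cross_mult_left)
qed (use offset.unit_e offset.unit_t offset.e_t \<sigma>_mem[OF s] in auto)

text \<open>By the chain rule \<open>(e\<^sub>1 \<circ> \<sigma>)' = \<sigma>' t\<^sub>1 = \<sigma>' g\<close>. On the other side only the summand
  \<open>sin \<theta> t'\<close> has a component along \<open>g\<close>, namely \<open>\<gamma> sin \<theta>\<close>.\<close>

lemma mannheim_speed:
  assumes s: "s \<in> I"
  shows "deriv \<sigma> s = surface.\<gamma> s * sin (\<theta> s)"
proof -
  note [derivative_intros] = surface.e_derivative[OF s] surface.t_derivative[OF s]
  have "deriv \<sigma> s *\<^sub>R surface.g s =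
      cos (\<theta> s) *\<^sub>R surface.t s + (- sin (\<theta> s) * deriv \<theta> s) *\<^sub>R e s +
      (sin (\<theta> s) *\<^sub>R (surface.\<gamma> s *\<^sub>R surface.g s - e s) + (cos (\<theta> s) * deriv \<theta> s) *\<^sub>R surface.t s)"
  proof (rule has_vector_derivative_eq_on_open[OF surface.open_I s])
    show "((\<lambda>u. e\<^sub>1 (\<sigma> u)) has_vector_derivative deriv \<sigma> s *\<^sub>R surface.g s) (at s)"
      using has_vector_derivative_along_\<sigma>[OF s offset.e_derivative[OF \<sigma>_mem[OF s]]]
      by (simp add: offset_t(1)[OF s])
    show "((\<lambda>u. cos (\<theta> u) *\<^sub>R e u + sin (\<theta> u) *\<^sub>R surface.t u) has_vector_derivative
      cos (\<theta> s) *\<^sub>R surface.t s + (- sin (\<theta> s) * deriv \<theta> s) *\<^sub>R e s +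
      (sin (\<theta> s) *\<^sub>R (surface.\<gamma> s *\<^sub>R surface.g s - e s) + (cos (\<theta> s) * deriv \<theta> s) *\<^sub>R surface.t s)) (at s)"
      by (auto intro!: derivative_eq_intros angle_derivative[OF s])
  qed (rule offset_e(1))
  from arg_cong[OF this, of "\<lambda>x. x \<bullet> surface.g s"] show ?thesis
    using surface.unit_g[OF s] by (simp add: inner_simps surface.e_g surface.t_g)
qed

text \<open>The left-hand side is the component of \<open>(c\<^sub>1 \<circ> \<sigma>)' = c' - \<gamma> \<theta>\<^sup>* t + (\<theta>\<^sup>*)' g\<close> along
  \<open>g\<^sub>1 = sin \<theta> e - cos \<theta> t\<close>. Since \<open>c\<close> is the striction curve, \<open>c'\<close> contributes through its
  component \<open>\<delta>\<close> along \<open>e\<close> alone.\<close>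

lemma mannheim_Delta:
  assumes s: "s \<in> I"
  shows "deriv \<sigma> s * Delta_fun c\<^sub>1 e\<^sub>1 (\<sigma> s) =
    delta_fun c e s * sin (\<theta> s) + surface.\<gamma> s * \<theta>\<^sub>d s * cos (\<theta> s)"
proof -
  define c' where "c' = vector_derivative c (at s)"
  define c\<^sub>1' where "c\<^sub>1' = vector_derivative c\<^sub>1 (at (\<sigma> s))"
  have c': "(c has_vector_derivative c') (at s)"
    and c\<^sub>1': "(c\<^sub>1 has_vector_derivative c\<^sub>1') (at (\<sigma> s))"
    using smooth_on_has_vector_derivative surface_ruled offset_ruled s \<sigma>_mem[OF s]
    unfolding ruled_surface_def c'_def c\<^sub>1'_def by blast+
  have c't: "c' \<bullet> surface.t s = 0"
    using surface_ruled s by (simp add: ruled_surface_def c'_def central_normal_def)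
  have "deriv \<sigma> s *\<^sub>R c\<^sub>1' =
      c' + (\<theta>\<^sub>d s *\<^sub>R (- surface.\<gamma> s *\<^sub>R surface.t s) + deriv \<theta>\<^sub>d s *\<^sub>R surface.g s)"
  proof (rule has_vector_derivative_eq_on_open[OF surface.open_I s])
    show "((\<lambda>u. c\<^sub>1 (\<sigma> u)) has_vector_derivative deriv \<sigma> s *\<^sub>R c\<^sub>1') (at s)"
      by (rule has_vector_derivative_along_\<sigma>[OF s c\<^sub>1'])
    show "((\<lambda>u. c u + \<theta>\<^sub>d u *\<^sub>R surface.g u) has_vector_derivative
      c' + (\<theta>\<^sub>d s *\<^sub>R (- surface.\<gamma> s *\<^sub>R surface.t s) + deriv \<theta>\<^sub>d s *\<^sub>R surface.g s)) (at s)"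
      by (intro derivative_intros c' distance_derivative[OF s] surface.g_derivative[OF s])
  qed (rule mannheim_striction_curve)
  from arg_cong[OF this, of "\<lambda>x. x \<bullet> offset.g (\<sigma> s)"]
  have "deriv \<sigma> s * (c\<^sub>1' \<bullet> offset.g (\<sigma> s)) =
      (c' \<bullet> e s) * sin (\<theta> s) + surface.\<gamma> s * \<theta>\<^sub>d s * cos (\<theta> s)"
    using surface.unit_t[OF s] surface.e_t[OF s] surface.e_g[of s] surface.t_g[of s] c't
    by (simp add: offset_g[OF s] inner_simps inner_commute algebra_simps)
  moreover have "Delta_fun c\<^sub>1 e\<^sub>1 (\<sigma> s) = c\<^sub>1' \<bullet> offset.g (\<sigma> s)"
    by (simp add: Delta_fun_def c\<^sub>1'_def asymptotic_normal_def dot_cross_det)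
  ultimately show ?thesis
    by (simp add: delta_fun_def c'_def)
qed

end

theorem corollary3p2:
  fixes I I\<^sub>1 :: "real set"
    and \<phi> \<phi>\<^sub>1 :: "real \<Rightarrow> real \<Rightarrow> real^3"
    and c e c\<^sub>1 e\<^sub>1 :: "real \<Rightarrow> real^3"
    and \<sigma> \<theta> \<theta>\<^sub>d :: "real \<Rightarrow> real"
  assumes "ruled_surface I \<phi> c e"
    and "ruled_surface I\<^sub>1 \<phi>\<^sub>1 c\<^sub>1 e\<^sub>1"
    and "mannheim_offset I c e I\<^sub>1 c\<^sub>1 e\<^sub>1 \<sigma>"
    and "dual_offset_angle I c e c\<^sub>1 e\<^sub>1 \<sigma> (\<lambda>s. Dual (\<theta> s) (\<theta>\<^sub>d s))"
    and "\<And>s. s \<in> I \<Longrightarrow> cos (\<theta> s) \<noteq> 0"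
  shows "developable I\<^sub>1 c\<^sub>1 e\<^sub>1 \<longleftrightarrow>
    (\<forall>s\<in>I. \<theta>\<^sub>d s = - (delta_fun c e s / conical_curvature e s) * tan (\<theta> s))"
proof -
  interpret mannheim_pair I I\<^sub>1 \<phi> \<phi>\<^sub>1 c e c\<^sub>1 e\<^sub>1 \<sigma> \<theta> \<theta>\<^sub>d
    using assms(1-4) by unfold_locales
  have "I\<^sub>1 = \<sigma> ` I"
    using assms(3) by (simp add: mannheim_offset_def bij_betw_def)
  then have "developable I\<^sub>1 c\<^sub>1 e\<^sub>1 \<longleftrightarrow> (\<forall>s\<in>I. Delta_fun c\<^sub>1 e\<^sub>1 (\<sigma> s) = 0)"
    by (simp add: developable_def)
  also have "\<dots> \<longleftrightarrow>
      (\<forall>s\<in>I. \<theta>\<^sub>d s = - (delta_fun c e s / conical_curvature e s) * tan (\<theta> s))"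
  proof (rule ball_cong[OF refl])
    fix s assume s: "s \<in> I"
    have \<sigma>': "deriv \<sigma> s \<noteq> 0"
      using assms(3) s by (simp add: mannheim_offset_def)
    then have "conical_curvature e s \<noteq> 0"
      using mannheim_speed[OF s] by auto
    moreover have "Delta_fun c\<^sub>1 e\<^sub>1 (\<sigma> s) = 0 \<longleftrightarrow>
        delta_fun c e s * sin (\<theta> s) + conical_curvature e s * \<theta>\<^sub>d s * cos (\<theta> s) = 0"
      using mannheim_Delta[OF s] \<sigma>' by (metis mult_eq_0_iff)
    ultimately show "Delta_fun c\<^sub>1 e\<^sub>1 (\<sigma> s) = 0 \<longleftrightarrow>
        \<theta>\<^sub>d s = - (delta_fun c e s / conical_curvature e s) * tan (\<theta> s)"
      using assms(5)[OF s] by (simp add: tan_def field_simps eq_neg_iff_add_eq_0)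
  qed
  finally show ?thesis .
qed

end
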